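(* Let $n,k\ge1$. A square Hermitian orthogonal design $\mathcal{O}_x$ of size $[n,n,2k-1]$ exists if and only if $2^{k-1}\mid n$. Moreover, for any such $\mathcal{O}_x$ there exist $U,V\in U_n(\mathbb{C})$ such that $$\mathcal{O}_x=U\,\mathrm{diag}(\mathcal{H}_{2k-1},\ldots,\mathcal{H}_{2k-1})\,V=U\big(I_{n/2^{k-1}}\otimes\mathcal{H}_{2k-1}\big)V.$$
   Context: Let $x_1,x_2,\ldots$ be formal real indeterminates. A Hermitian orthogonal design (HOD) of size $[p,n,m]$ is a $p\times n$ matrix $\mathcal{O}_x$ whose entries are complex linear combinations of $x_1,\ldots,x_m$ such that $\mathcal{O}_x^H\mathcal{O}_x=(x_1^2+\cdots+x_m^2)I_n$; it is square if $p=n$. Define $\mathcal{H}_2=(x_1+x_2\sqrt{-1})$ and for $k>1$ the $2^{k-1}\times2^{k-1}$ matrix $$\mathcal{H}_{2k}=\begin{pmatrix}\mathcal{H}_{2k-2} & (x_{2k-1}+x_{2k}\sqrt{-1})I_{2^{k-2}}\\ -(x_{2k-1}-x_{2k}\sqrt{-1})I_{2^{k-2}} & \mathcal{H}_{2k-2}^H\end{pmatrix},$$ where $^H$ is conjugate transpose with the $x_i$ treated as real. Let $\mathcal{H}_{2k-1}$ be the matrix obtained from $\mathcal{H}_{2k}$ by setting $x_{2k}=0$. $U_n(\mathbb{C})$ is the group of $n\times n$ unitary matrices. *)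

theory Defs
  imports Complex_Main "Jordan_Normal_Form.Matrix"
begin

definition ctrans :: "complex mat \<Rightarrow> complex mat" where
  "ctrans A = mat (dim_col A) (dim_row A) (\<lambda>(i,j). cnj (A $$ (j,i)))"

definition unitary_mat :: "nat \<Rightarrow> complex mat \<Rightarrow> bool" where
  "unitary_mat n U \<longleftrightarrow> U \<in> carrier_mat n n \<and> ctrans U * U = 1\<^sub>m n \<and> U * ctrans U = 1\<^sub>m n"

text \<open>A p x n design in real variables x_1..x_m with complex coefficients is given by
  its coefficient matrices A_1..A_m: O_x = x_1 A_1 + ... + x_m A_m.
  Evaluating at a real point x (variables indexed from 1):\<close>
definition design_eval :: "nat \<Rightarrow> nat \<Rightarrow> nat \<Rightarrow> (nat \<Rightarrow> complex mat) \<Rightarrow> (nat \<Rightarrow> real) \<Rightarrow> complex mat" where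
  "design_eval p n m A x = mat p n (\<lambda>(r,c). \<Sum>i=1..m. complex_of_real (x i) * (A i $$ (r,c)))"

text \<open>Hermitian orthogonal design of size [p,n,m]: O_x^H O_x = (x_1^2+...+x_m^2) I_n as an
  identity in the real indeterminates (equivalently, for all real values of them).\<close>
definition is_HOD :: "nat \<Rightarrow> nat \<Rightarrow> nat \<Rightarrow> (nat \<Rightarrow> complex mat) \<Rightarrow> bool" where
  "is_HOD p n m A \<longleftrightarrow> (\<forall>i\<in>{1..m}. A i \<in> carrier_mat p n) \<and>
     (\<forall>x::nat \<Rightarrow> real. ctrans (design_eval p n m A x) * design_eval p n m A x
        = complex_of_real (\<Sum>i=1..m. (x i)^2) \<cdot>\<^sub>m 1\<^sub>m n)"

text \<open>Hev k x = H_{2k} evaluated at x, a 2^(k-1) x 2^(k-1) matrix (k \<ge> 1).\<close>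
fun Hev :: "nat \<Rightarrow> (nat \<Rightarrow> real) \<Rightarrow> complex mat" where
  "Hev 0 x = 1\<^sub>m 0"
| "Hev (Suc 0) x = mat 1 1 (\<lambda>_. Complex (x 1) (x 2))"
| "Hev (Suc (Suc k)) x =
     (let K = Suc (Suc k); P = Hev (Suc k) x; d = 2 ^ k in
      four_block_mat P (Complex (x (2*K - 1)) (x (2*K)) \<cdot>\<^sub>m 1\<^sub>m d)
                       ((- Complex (x (2*K - 1)) (- x (2*K))) \<cdot>\<^sub>m 1\<^sub>m d) (ctrans P))"

definition Hodd :: "nat \<Rightarrow> (nat \<Rightarrow> real) \<Rightarrow> complex mat" where
  "Hodd k x = Hev k (x(2*k := 0))"

definition blockdiag_rep :: "nat \<Rightarrow> complex mat \<Rightarrow> complex mat" where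
  "blockdiag_rep r B = (let d = dim_row B in
     mat (r*d) (r*d) (\<lambda>(i,j). if i div d = j div d then B $$ (i mod d, j mod d) else 0))"

end

theory Submission
  imports Defs "Jordan_Normal_Form.Schur_Decomposition"
begin

text \<open>
  A square design in \<^term>\<open>m + 2\<close> variables can be halved. Normalise its coefficient matrix at
  \<^term>\<open>m + 1\<close> to the identity; the coefficient at \<^term>\<open>m + 2\<close> is then skew-Hermitian and
  squares to \<open>-1\<close>, so a unitary change of basis turns it into \<open>diag(\<i>I, -\<i>I)\<close>. The other
  coefficients are skew-Hermitian and anticommute with it, hence are block off-diagonal, and if
  there is at least one of them the two blocks have equal size. Thus the design is
  unitarily equivalent to \<open>((W, zI), (-cnj z I, ctrans W))\<close> with \<open>z\<close> built from the last two
  variables and \<open>W\<close> a design of half the size in the first \<open>m\<close> variables, and the equivalence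
  class of \<open>W\<close> determines that of the design. Starting from one variable, where a design is a
  single unitary matrix, induction gives both the divisibility and the fact that any two square
  designs of the same size in \<open>2k - 1\<close> variables are equivalent. The block-diagonal sum of copies
  of \<open>H_{2k-1}\<close> is one such design.
\<close>

section \<open>Conjugate transposes and unitary matrices\<close>

lemma dim_ctrans [simp]: "dim_row (ctrans A) = dim_col A" "dim_col (ctrans A) = dim_row A"
  by (simp_all add: ctrans_def)

lemma index_ctrans [simp]:
  "i < dim_col A \<Longrightarrow> j < dim_row A \<Longrightarrow> ctrans A $$ (i, j) = cnj (A $$ (j, i))"
  by (simp add: ctrans_def)

lemma ctrans_carrier [simp]: "A \<in> carrier_mat p q \<Longrightarrow> ctrans A \<in> carrier_mat q p"
  by (intro carrier_matI) auto

lemma ctrans_ctrans [simp]: "ctrans (ctrans A) = A"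
  by (rule eq_matI) auto

lemma ctrans_add:
  "A \<in> carrier_mat p q \<Longrightarrow> B \<in> carrier_mat p q \<Longrightarrow> ctrans (A + B) = ctrans A + ctrans B"
  by (rule eq_matI) auto

lemma ctrans_smult: "ctrans (c \<cdot>\<^sub>m A) = cnj c \<cdot>\<^sub>m ctrans A"
  by (rule eq_matI) auto

lemma ctrans_uminus: "ctrans (- A) = - ctrans A"
  by (rule eq_matI) auto

lemma ctrans_one [simp]: "ctrans (1\<^sub>m n) = 1\<^sub>m n"
  by (rule eq_matI) auto

lemma ctrans_zero [simp]: "ctrans (0\<^sub>m p q) = 0\<^sub>m q p"
  by (rule eq_matI) auto

lemma ctrans_mult:
  assumes "A \<in> carrier_mat p q" "B \<in> carrier_mat q r"
  shows "ctrans (A * B) = ctrans B * ctrans A"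
  using assms by (intro eq_matI) (auto simp: scalar_prod_def mult.commute intro!: sum.cong)

lemma ctrans_four_block_mat:
  assumes "A \<in> carrier_mat p1 q1" "B \<in> carrier_mat p1 q2"
    "C \<in> carrier_mat p2 q1" "D \<in> carrier_mat p2 q2"
  shows "ctrans (four_block_mat A B C D) =
    four_block_mat (ctrans A) (ctrans C) (ctrans B) (ctrans D)"
  using assms by (intro eq_matI) auto

lemma four_block_mat_eqD:
  assumes "four_block_mat A B C D = four_block_mat A' B' C' D'"
    "A \<in> carrier_mat p1 q1" "B \<in> carrier_mat p1 q2"
    "C \<in> carrier_mat p2 q1" "D \<in> carrier_mat p2 q2"
    "A' \<in> carrier_mat p1 q1" "B' \<in> carrier_mat p1 q2"
    "C' \<in> carrier_mat p2 q1" "D' \<in> carrier_mat p2 q2"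
  shows "A = A'" "B = B'" "C = C'" "D = D'"
proof -
  have e: "four_block_mat A B C D $$ (i, j) = four_block_mat A' B' C' D' $$ (i, j)" for i j
    using assms(1) by simp
  show "A = A'"
  proof (rule eq_matI)
    fix i j assume "i < dim_row A'" "j < dim_col A'"
    then show "A $$ (i, j) = A' $$ (i, j)" using e[of i j] assms(2-) by auto
  qed (use assms(2-) in auto)
  show "B = B'"
  proof (rule eq_matI)
    fix i j assume "i < dim_row B'" "j < dim_col B'"
    then show "B $$ (i, j) = B' $$ (i, j)" using e[of i "j + q1"] assms(2-) by auto
  qed (use assms(2-) in auto)
  show "C = C'"
  proof (rule eq_matI)
    fix i j assume "i < dim_row C'" "j < dim_col C'"
    then show "C $$ (i, j) = C' $$ (i, j)" using e[of "i + p1" j] assms(2-) by auto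
  qed (use assms(2-) in auto)
  show "D = D'"
  proof (rule eq_matI)
    fix i j assume "i < dim_row D'" "j < dim_col D'"
    then show "D $$ (i, j) = D' $$ (i, j)" using e[of "i + p1" "j + q1"] assms(2-) by auto
  qed (use assms(2-) in auto)
qed

section \<open>Unitary matrices and their closure properties\<close>

lemma unitary_matI:
  assumes "U \<in> carrier_mat n n" "ctrans U * U = 1\<^sub>m n"
  shows "unitary_mat n U"
  using assms mat_mult_left_right_inverse[of "ctrans U" n U] by (simp add: unitary_mat_def)

lemma unitary_mat_carrier: "unitary_mat n U \<Longrightarrow> U \<in> carrier_mat n n"
  by (simp add: unitary_mat_def)

lemma unitary_mat_ctrans [simp]: "unitary_mat n U \<Longrightarrow> unitary_mat n (ctrans U)"
  by (simp add: unitary_mat_def)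

lemma unitary_mat_one [simp]: "unitary_mat n (1\<^sub>m n)"
  by (simp add: unitary_mat_def)

text \<open>Long products are normalised by associating to the right. A unitary factor and its
  conjugate transpose then meet in the shape \<open>ctrans U * (U * X)\<close>, which simplification
  can cancel.\<close>

lemma unitary_mat_cancel:
  assumes "unitary_mat n U" "X \<in> carrier_mat n p"
  shows "ctrans U * (U * X) = X" "U * (ctrans U * X) = X"
proof -
  have U: "U \<in> carrier_mat n n" "ctrans U * U = 1\<^sub>m n" "U * ctrans U = 1\<^sub>m n"
    using assms(1) by (auto simp: unitary_mat_def)
  show "ctrans U * (U * X) = X"
    using assoc_mult_mat[of "ctrans U" n n U n X p] U assms(2) by simp
  show "U * (ctrans U * X) = X"
    using assoc_mult_mat[of U n n "ctrans U" n X p] U assms(2) by simp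
qed

lemma unitary_mat_mult:
  assumes "unitary_mat n U" "unitary_mat n V"
  shows "unitary_mat n (U * V)"
proof (rule unitary_matI)
  have c: "U \<in> carrier_mat n n" "V \<in> carrier_mat n n" using assms by (auto dest: unitary_mat_carrier)
  then show "U * V \<in> carrier_mat n n" by simp
  show "ctrans (U * V) * (U * V) = 1\<^sub>m n"
    using assms c by (simp add: ctrans_mult[OF c] assoc_mult_mat[of _ n n _ n _ n] unitary_mat_cancel)
      (simp add: unitary_mat_def)
qed

lemma unitary_mat_block_diag:
  assumes U: "unitary_mat a U" and V: "unitary_mat b V"
  shows "unitary_mat (a + b) (four_block_mat U (0\<^sub>m a b) (0\<^sub>m b a) V)"
proof (rule unitary_matI)
  have c: "U \<in> carrier_mat a a" "V \<in> carrier_mat b b" using assms by (auto dest: unitary_mat_carrier)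
  then show "four_block_mat U (0\<^sub>m a b) (0\<^sub>m b a) V \<in> carrier_mat (a + b) (a + b)" by simp
  show "ctrans (four_block_mat U (0\<^sub>m a b) (0\<^sub>m b a) V) * four_block_mat U (0\<^sub>m a b) (0\<^sub>m b a) V = 1\<^sub>m (a + b)"
    using c assms
    by (simp add: ctrans_four_block_mat[OF c(1) zero_carrier_mat zero_carrier_mat c(2)]
        mult_four_block_mat[of _ a a _ b _ b _ _ a _ b] unitary_mat_def)
qed

text \<open>Complete \<open>v\<close> to a basis and run Gram-Schmidt, which keeps the head
  \<open>v\<close> and makes the list orthogonal; dividing each vector by its norm then gives the
  columns of \<open>Q\<close>. The scalar \<open>c\<close> is the inverse norm of
  \<open>v\<close>.\<close>

lemma unitary_mat_extend_vec:
  fixes v :: "complex vec"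
  assumes v: "v \<in> carrier_vec n" and v0: "v \<noteq> 0\<^sub>v n"
  obtains Q c where "unitary_mat n Q" "col Q 0 = c \<cdot>\<^sub>v v" "n \<noteq> 0"
proof -
  interpret cof_vec_space n "TYPE(complex)" .
  have n: "n \<noteq> 0" using v v0 by (metis carrier_vecD dim_vec eq_vecI index_zero_vec(2) less_nat_zero_code)
  define b where "b = basis_completion v"
  define ws where "ws = gram_schmidt n b"
  note bc = basis_completion[OF v v0, folded b_def]
  obtain vs where bv: "b = v # vs" using bc(6,7) n by (cases b) auto
  have ws: "set ws \<subseteq> carrier_vec n" "corthogonal ws" "length ws = n"
    using gram_schmidt_result[OF bc(2,4,5) refl, folded ws_def] bc(6) by auto
  have hd: "ws ! 0 = v"
    using gram_schmidt_hd[OF v, of vs, folded bv] ws(3) n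
    by (metis hd_conv_nth length_0_conv ws_def)
  define s where "s j = (\<Sum>i<n. (cmod (ws ! j $ i))\<^sup>2)" for j
  define Q where "Q = mat n n (\<lambda>(i, j). ws ! j $ i / sqrt (s j))"
  have wsc: "ws ! j \<in> carrier_vec n" if "j < n" for j using ws that by auto
  have sp: "ws ! j \<bullet>c ws ! i = (\<Sum>l<n. ws ! j $ l * cnj (ws ! i $ l))" if "i < n" "j < n" for i j
    using wsc[OF that(1)] wsc[OF that(2)] by (simp add: scalar_prod_def atLeast0LessThan)
  have ss: "of_real (s j) = ws ! j \<bullet>c ws ! j" if "j < n" for j
    unfolding sp[OF that that] s_def by (simp add: complex_norm_square del: of_real_power)
  \<comment> \<open>\<open>corthogonal\<close> also says that each vector has a non-zero product
    with itself, so division by the norms is legitimate.\<close>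
  have spos: "s j > 0" if "j < n" for j
  proof -
    have "of_real (s j) \<noteq> (0::complex)"
      using ss[OF that] corthogonalD[OF ws(2), of j j] that ws(3) by auto
    moreover have "s j \<ge> 0" unfolding s_def by (intro sum_nonneg) auto
    ultimately show ?thesis by auto
  qed
  have "unitary_mat n Q"
  proof (rule unitary_matI)
    show "Q \<in> carrier_mat n n" by (simp add: Q_def)
    show "ctrans Q * Q = 1\<^sub>m n"
    proof (rule eq_matI)
      fix i j assume ij: "i < dim_row (1\<^sub>m n)" "j < dim_col (1\<^sub>m n)"
      then have ij: "i < n" "j < n" by auto
      have "(ctrans Q * Q) $$ (i, j) = (\<Sum>l<n. cnj (ws ! i $ l / sqrt (s i)) * (ws ! j $ l / sqrt (s j)))"
        using ij by (simp add: Q_def scalar_prod_def atLeast0LessThan)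
      also have "\<dots> = (\<Sum>l<n. ws ! j $ l * cnj (ws ! i $ l)) / (sqrt (s i) * sqrt (s j))"
        unfolding sum_divide_distrib by (intro sum.cong) auto
      also have "\<dots> = (ws ! j \<bullet>c ws ! i) / (sqrt (s i) * sqrt (s j))"
        by (simp add: sp ij)
      also have "\<dots> = (if i = j then 1 else 0)"
      proof (cases "i = j")
        case True
        have "complex_of_real (sqrt (s j)) * complex_of_real (sqrt (s j)) = of_real (s j)"
          using spos[OF ij(2)] by (simp flip: of_real_mult)
        then show ?thesis using True ss[OF ij(2)] spos[OF ij(2)] by auto
      next
        case False
        then show ?thesis using corthogonalD[OF ws(2), of j i] ij ws(3) by auto
      qed
      finally show "(ctrans Q * Q) $$ (i, j) = 1\<^sub>m n $$ (i, j)" using ij by simp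
    qed (simp_all add: Q_def)
  qed
  moreover have "col Q 0 = complex_of_real (1 / sqrt (s 0)) \<cdot>\<^sub>v v"
    using n v hd by (intro eq_vecI) (auto simp: Q_def)
  ultimately show thesis using that n by blast
qed

lemma mult_square_carrier_mat [simp]:
  "A \<in> carrier_mat n n \<Longrightarrow> B \<in> carrier_mat n n \<Longrightarrow> A * B \<in> carrier_mat n n"
  by (rule mult_carrier_mat)

lemma smult_one_mult_mat [simp]:
  fixes A :: "'a :: comm_ring_1 mat"
  shows "A \<in> carrier_mat n p \<Longrightarrow> (c \<cdot>\<^sub>m 1\<^sub>m n) * A = c \<cdot>\<^sub>m A"
    and "A \<in> carrier_mat p n \<Longrightarrow> A * (c \<cdot>\<^sub>m 1\<^sub>m n) = c \<cdot>\<^sub>m A"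
  by (auto simp: mult_smult_distrib[of _ p n _ n] mult_smult_assoc_mat[of _ n n _ p])

lemma one_smult_mat [simp]: "(1 :: 'a :: monoid_mult) \<cdot>\<^sub>m A = A"
  by (rule eq_matI) auto

lemma uminus_zero_mat [simp]: "- 0\<^sub>m p q = (0\<^sub>m p q :: 'a :: group_add mat)"
  by (rule eq_matI) auto

lemma block_diag_mult:
  fixes A B C D :: "'a :: comm_ring_1 mat"
  assumes "A \<in> carrier_mat a a" "B \<in> carrier_mat b b" "C \<in> carrier_mat a a" "D \<in> carrier_mat b b"
  shows "four_block_mat A (0\<^sub>m a b) (0\<^sub>m b a) B * four_block_mat C (0\<^sub>m a b) (0\<^sub>m b a) D =
    four_block_mat (A * C) (0\<^sub>m a b) (0\<^sub>m b a) (B * D)"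
  using assms by (simp add: mult_four_block_mat[of _ a a _ b _ b _ _ a _ b])

lemma ctrans_block_diag:
  assumes "A \<in> carrier_mat a a" "B \<in> carrier_mat b b"
  shows "ctrans (four_block_mat A (0\<^sub>m a b) (0\<^sub>m b a) B) =
    four_block_mat (ctrans A) (0\<^sub>m a b) (0\<^sub>m b a) (ctrans B)"
  using ctrans_four_block_mat[OF assms(1) zero_carrier_mat zero_carrier_mat assms(2)] by simp

text \<open>Deflation: unless \<open>S\<close> is minus the identity it has a fixed vector, and a
  unitary matrix with that direction as first column splits off a leading entry 1. What remains is
  again a Hermitian involution. The recursion stops at minus the identity, so all entries 1 precede
  all entries -1.\<close>

lemma hermitian_involution_diagonalization:
  assumes "S \<in> carrier_mat n n" "ctrans S = S" "S * S = 1\<^sub>m n"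
  shows "\<exists>Q a b. a + b = n \<and> unitary_mat n Q \<and>
    ctrans Q * S * Q = four_block_mat (1\<^sub>m a) (0\<^sub>m a b) (0\<^sub>m b a) (- 1\<^sub>m b)"
  using assms
proof (induction n arbitrary: S)
  case 0
  have "ctrans (1\<^sub>m 0) * S * 1\<^sub>m 0 = four_block_mat (1\<^sub>m 0) (0\<^sub>m 0 0) (0\<^sub>m 0 0) (- 1\<^sub>m 0)"
    using 0 by (intro eq_matI) auto
  then show ?case by (metis add_0 unitary_mat_one)
next
  case (Suc m)
  let ?n = "Suc m"
  note S = Suc.prems
  show ?case
  proof (cases "S = - 1\<^sub>m ?n")
    case True
    have "ctrans (1\<^sub>m ?n) * S * 1\<^sub>m ?n = four_block_mat (1\<^sub>m 0) (0\<^sub>m 0 ?n) (0\<^sub>m ?n 0) (- 1\<^sub>m ?n)"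
      unfolding True by (intro eq_matI) auto
    then show ?thesis by (metis add_0 unitary_mat_one)
  next
    case False
    have "\<exists>j<?n. col (1\<^sub>m ?n + S) j \<noteq> 0\<^sub>v ?n"
    proof (rule ccontr)
      assume "\<not> ?thesis"
      then have z: "col (1\<^sub>m ?n + S) j $ i = 0" if "j < ?n" "i < ?n" for i j using that by simp
      have "S = - 1\<^sub>m ?n"
      proof (rule eq_matI)
        fix i j assume "i < dim_row (- 1\<^sub>m ?n :: complex mat)" "j < dim_col (- 1\<^sub>m ?n :: complex mat)"
        then show "S $$ (i, j) = (- 1\<^sub>m ?n) $$ (i, j)"
          using z[of j i] S(1) by (auto simp: add_eq_0_iff split: if_splits)
      qed (use S(1) in auto)
      then show False using False by simp
    qed
    then obtain j where j: "j < ?n" "col (1\<^sub>m ?n + S) j \<noteq> 0\<^sub>v ?n" by blast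
    define v where "v = col (1\<^sub>m ?n + S) j"
    have v: "v \<in> carrier_vec ?n" using S(1) unfolding v_def by (intro col_carrier_vec[of _ ?n]) (auto simp: j)
    \<comment> \<open>Since \<open>S * S\<close> is the identity, every column of
      \<open>1\<^sub>m ?n + S\<close> is fixed by \<open>S\<close>; the non-zero column
      \<open>v\<close> is therefore an eigenvector for 1.\<close>
    have "S * (1\<^sub>m ?n + S) = 1\<^sub>m ?n + S"
      using S by (simp add: mult_add_distrib_mat[of _ ?n ?n _ ?n] comm_add_mat[of _ ?n ?n])
    then have Sv: "S *\<^sub>v v = v"
      using col_mult2[of S ?n ?n "1\<^sub>m ?n + S" ?n j] S(1) j(1) by (simp add: v_def)
    obtain Q c where Q: "unitary_mat ?n Q" and Qv: "col Q 0 = c \<cdot>\<^sub>v v"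
      using unitary_mat_extend_vec[OF v] j(2) by (auto simp: v_def)
    have Qc: "Q \<in> carrier_mat ?n ?n" using Q by (rule unitary_mat_carrier)
    define S' where "S' = ctrans Q * (S * Q)"
    have S'c: "S' \<in> carrier_mat ?n ?n" using Qc S(1) by (simp add: S'_def)
    have "col (S * Q) 0 = col Q 0"
      using col_mult2[of S ?n ?n Q ?n 0] S(1) Qc Qv Sv v by (simp add: mult_mat_vec[of S ?n ?n])
    then have "col S' 0 = col (1\<^sub>m ?n) 0"
      using col_mult2[of "ctrans Q" ?n ?n "S * Q" ?n 0] col_mult2[of "ctrans Q" ?n ?n Q ?n 0] S(1) Qc Q
      by (simp add: S'_def unitary_mat_def)
    then have S'0: "S' $$ (i, 0) = (if i = 0 then 1 else 0)" if "i < ?n" for i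
      using index_col[of i S' 0] S'c that by simp
    have S'h: "ctrans S' = S'"
      using S Qc by (simp add: S'_def ctrans_mult[of _ ?n ?n _ ?n] assoc_mult_mat[of _ ?n ?n _ ?n _ ?n])
    \<comment> \<open>The first row comes from the first column because \<open>S'\<close> is
      Hermitian.\<close>
    have S'0': "S' $$ (0, i) = (if i = 0 then 1 else 0)" if "i < ?n" for i
    proof -
      have "S' $$ (0, i) = cnj (S' $$ (i, 0))"
        using index_ctrans[of 0 S' i] S'c that by (simp add: S'h)
      then show ?thesis using S'0[OF that] by simp
    qed
    have S'S': "S' * S' = 1\<^sub>m ?n"
    proof -
      have "S' * S' = ctrans Q * (S * (Q * (ctrans Q * (S * Q))))"
        using S Qc by (simp add: S'_def assoc_mult_mat[of _ ?n ?n _ ?n _ ?n])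
      also have "\<dots> = ctrans Q * (S * S * Q)"
        using S(1) Qc Q by (simp add: unitary_mat_cancel[of ?n _ _ ?n] assoc_mult_mat[of _ ?n ?n _ ?n _ ?n])
      also have "\<dots> = 1\<^sub>m ?n" using S(3) Q Qc by (simp add: unitary_mat_def)
      finally show ?thesis .
    qed
    define T where "T = mat m m (\<lambda>(i, j). S' $$ (Suc i, Suc j))"
    have Tc: "T \<in> carrier_mat m m" by (simp add: T_def)
    have S'T: "S' = four_block_mat (1\<^sub>m 1) (0\<^sub>m 1 m) (0\<^sub>m m 1) T"
    proof (rule eq_matI)
      fix i j assume "i < dim_row (four_block_mat (1\<^sub>m 1) (0\<^sub>m 1 m) (0\<^sub>m m 1) T)"
        "j < dim_col (four_block_mat (1\<^sub>m 1) (0\<^sub>m 1 m) (0\<^sub>m m 1) T)"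
      then show "S' $$ (i, j) = four_block_mat (1\<^sub>m 1) (0\<^sub>m 1 m) (0\<^sub>m m 1) T $$ (i, j)"
        using S'0[of i] S'0'[of j] by (cases i; cases j) (auto simp: T_def)
    qed (use S'c Tc in auto)
    have Th: "ctrans T = T"
      using S'h Tc unfolding S'T
      by (subst (asm) ctrans_block_diag) (auto dest!: four_block_mat_eqD[of _ _ _ _ _ _ _ _ 1 1 m m])
    have TT: "T * T = 1\<^sub>m m"
    proof -
      have "four_block_mat (1\<^sub>m 1) (0\<^sub>m 1 m) (0\<^sub>m m 1) (T * T) = four_block_mat (1\<^sub>m 1) (0\<^sub>m 1 m) (0\<^sub>m m 1) (1\<^sub>m m)"
        using S'S' Tc unfolding S'T by (simp add: block_diag_mult)
      from four_block_mat_eqD(4)[OF this, of 1 1 m m] show ?thesis using Tc by simp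
    qed
    from Suc.IH[OF Tc Th TT] obtain Q' a b where ab: "a + b = m" and Q': "unitary_mat m Q'"
      and J: "ctrans Q' * T * Q' = four_block_mat (1\<^sub>m a) (0\<^sub>m a b) (0\<^sub>m b a) (- 1\<^sub>m b)" by blast
    have Q'c: "Q' \<in> carrier_mat m m" using Q' by (rule unitary_mat_carrier)
    define P where "P = four_block_mat (1\<^sub>m 1) (0\<^sub>m 1 m) (0\<^sub>m m 1) Q'"
    have P: "unitary_mat ?n P" using unitary_mat_block_diag[OF unitary_mat_one[of 1] Q'] by (simp add: P_def)
    then have Pc: "P \<in> carrier_mat ?n ?n" by (rule unitary_mat_carrier)
    have "ctrans (Q * P) * S * (Q * P) = ctrans P * S' * P"
      using S Qc Pc by (simp add: S'_def ctrans_mult[of _ ?n ?n _ ?n] assoc_mult_mat[of _ ?n ?n _ ?n _ ?n])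
    also have "\<dots> = four_block_mat (1\<^sub>m 1) (0\<^sub>m 1 m) (0\<^sub>m m 1) (ctrans Q' * T * Q')"
      using Tc Q'c by (simp add: S'T P_def ctrans_block_diag block_diag_mult)
    also have "\<dots> = four_block_mat (1\<^sub>m (Suc a)) (0\<^sub>m (Suc a) b) (0\<^sub>m b (Suc a)) (- 1\<^sub>m b)"
      unfolding J using ab by (intro eq_matI) auto
    finally show ?thesis using ab unitary_mat_mult[OF Q P] by (metis add_Suc)
  qed
qed

section \<open>Square designs as real-linear matrix functions\<close>

text \<open>The design is represented by its evaluation map on real points; the fourth clause says that
  only the variables with index in \<^term>\<open>{1..m}\<close> occur.\<close>

definition square_hod :: "nat \<Rightarrow> nat \<Rightarrow> ((nat \<Rightarrow> real) \<Rightarrow> complex mat) \<Rightarrow> bool" where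
  "square_hod n m F \<longleftrightarrow>
     (\<forall>x. F x \<in> carrier_mat n n) \<and>
     (\<forall>x y. F (\<lambda>i. x i + y i) = F x + F y) \<and>
     (\<forall>c x. F (\<lambda>i. c * x i) = complex_of_real c \<cdot>\<^sub>m F x) \<and>
     (\<forall>x y. (\<forall>i\<in>{1..m}. x i = y i) \<longrightarrow> F x = F y) \<and>
     (\<forall>x. ctrans (F x) * F x = complex_of_real (\<Sum>i=1..m. (x i)\<^sup>2) \<cdot>\<^sub>m 1\<^sub>m n)"

lemma square_hodD:
  assumes "square_hod n m F"
  shows "F x \<in> carrier_mat n n"
    and "F (\<lambda>i. x i + y i) = F x + F y"
    and "F (\<lambda>i. c * x i) = complex_of_real c \<cdot>\<^sub>m F x"
    and "(\<And>i. i \<in> {1..m} \<Longrightarrow> x i = y i) \<Longrightarrow> F x = F y"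
    and "ctrans (F x) * F x = complex_of_real (\<Sum>i=1..m. (x i)\<^sup>2) \<cdot>\<^sub>m 1\<^sub>m n"
  using assms unfolding square_hod_def by blast+

text \<open>Subtracting the norm identities at \<open>x\<close> and \<open>y\<close> from the one at
  their sum leaves only the cross terms, and \<open>orth\<close> removes the mixed part of the
  squared norm. With a coordinate point as one argument this is the source of all skewness and
  anticommutation relations.\<close>

lemma square_hod_polarization:
  assumes F: "square_hod n m F" and orth: "(\<Sum>i=1..m. x i * y i) = 0"
  shows "ctrans (F x) * F y + ctrans (F y) * F x = 0\<^sub>m n n"
proof -
  note c = square_hodD(1)[OF F]
  have "(\<Sum>i=1..m. (x i + y i)\<^sup>2) = (\<Sum>i=1..m. (x i)\<^sup>2) + (\<Sum>i=1..m. (y i)\<^sup>2) + 2 * (\<Sum>i=1..m. x i * y i)"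
    by (simp add: power2_sum sum.distrib sum_distrib_left algebra_simps)
  then have "complex_of_real ((\<Sum>i=1..m. (x i)\<^sup>2) + (\<Sum>i=1..m. (y i)\<^sup>2)) \<cdot>\<^sub>m 1\<^sub>m n =
      ctrans (F x + F y) * (F x + F y)"
    using square_hodD(5)[OF F, of "\<lambda>i. x i + y i"] orth
    by (simp add: square_hodD(2)[OF F] del: of_real_sum of_real_add)
  also have "\<dots> = (ctrans (F x) * F x + ctrans (F y) * F x) + (ctrans (F x) * F y + ctrans (F y) * F y)"
    using c[of x] c[of y]
    by (simp add: ctrans_add[of _ n n] mult_add_distrib_mat[of _ n n _ n] add_mult_distrib_mat[of _ n n _ _ n])
  finally have e: "complex_of_real ((\<Sum>i=1..m. (x i)\<^sup>2) + (\<Sum>i=1..m. (y i)\<^sup>2)) \<cdot>\<^sub>m 1\<^sub>m n =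
    (complex_of_real (\<Sum>i=1..m. (x i)\<^sup>2) \<cdot>\<^sub>m 1\<^sub>m n + ctrans (F y) * F x) +
    (ctrans (F x) * F y + complex_of_real (\<Sum>i=1..m. (y i)\<^sup>2) \<cdot>\<^sub>m 1\<^sub>m n)"
    unfolding square_hodD(5)[OF F] .
  define X Y where "X = ctrans (F x) * F y" and "Y = ctrans (F y) * F x"
  have XY: "X \<in> carrier_mat n n" "Y \<in> carrier_mat n n" using c[of x] c[of y] by (auto simp: X_def Y_def)
  show ?thesis
    unfolding X_def[symmetric] Y_def[symmetric]
  proof (rule eq_matI)
    fix i j assume "i < dim_row (0\<^sub>m n n :: complex mat)" "j < dim_col (0\<^sub>m n n :: complex mat)"
    then have ij: "i < n" "j < n" by auto
    from arg_cong[OF e[folded X_def Y_def], of "\<lambda>M. M $$ (i, j)"]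
    show "(X + Y) $$ (i, j) = 0\<^sub>m n n $$ (i, j)"
      using ij XY by (auto simp: algebra_simps split: if_splits)
  qed (use XY in auto)
qed

lemma square_hod_unitary_mult:
  assumes F: "square_hod n m F" and U: "unitary_mat n U" and V: "unitary_mat n V"
  shows "square_hod n m (\<lambda>x. U * F x * V)"
  unfolding square_hod_def
proof (intro conjI allI impI)
  note c = square_hodD(1)[OF F]
  have UV: "U \<in> carrier_mat n n" "V \<in> carrier_mat n n" using U V by (auto dest: unitary_mat_carrier)
  show "U * F x * V \<in> carrier_mat n n" for x using c[of x] UV by simp
  show "U * F (\<lambda>i. x i + y i) * V = U * F x * V + U * F y * V" for x y
    using c[of x] c[of y] UV
    by (simp add: square_hodD(2)[OF F] mult_add_distrib_mat[of _ n n _ n] add_mult_distrib_mat[of _ n n _ _ n])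
  show "U * F (\<lambda>i. r * x i) * V = complex_of_real r \<cdot>\<^sub>m (U * F x * V)" for r x
    using c[of x] UV
    by (simp add: square_hodD(3)[OF F] mult_smult_distrib[of _ n n _ n] mult_smult_assoc_mat[of _ n n _ n])
  show "U * F x * V = U * F y * V" if "\<forall>i\<in>{1..m}. x i = y i" for x y
    using square_hodD(4)[OF F, of x y] that by simp
  show "ctrans (U * F x * V) * (U * F x * V) = complex_of_real (\<Sum>i=1..m. (x i)\<^sup>2) \<cdot>\<^sub>m 1\<^sub>m n" for x
  proof -
    have "ctrans (U * F x * V) * (U * F x * V) = ctrans V * (ctrans (F x) * (ctrans U * (U * (F x * V))))"
      using c[of x] UV by (simp add: ctrans_mult[of _ n n _ n] assoc_mult_mat[of _ n n _ n _ n])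
    also have "\<dots> = ctrans V * ((ctrans (F x) * F x) * V)"
      using c[of x] UV U by (simp add: unitary_mat_cancel[of n _ _ n] assoc_mult_mat[of _ n n _ n _ n])
    also have "\<dots> = complex_of_real (\<Sum>i=1..m. (x i)\<^sup>2) \<cdot>\<^sub>m (ctrans V * V)"
      unfolding square_hodD(5)[OF F] using UV by (simp add: mult_smult_distrib[of _ n n _ n])
    finally show ?thesis using V by (simp add: unitary_mat_def)
  qed
qed

text \<open>The coordinate vectors: the value of a design at \<open>unit_point j\<close> is the
  coefficient matrix of the variable with index \<open>j\<close>.\<close>

definition unit_point :: "nat \<Rightarrow> nat \<Rightarrow> real" where
  "unit_point j = (\<lambda>i. if i = j then 1 else 0)"

lemma sum_unit_point:
  "j \<in> {1..m} \<Longrightarrow> (\<Sum>i=1..m. (unit_point j i)\<^sup>2) = 1"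
  "j \<in> {1..m} \<Longrightarrow> (\<Sum>i=1..m. unit_point j i * x i) = x j"
  by (simp_all add: unit_point_def if_distrib[of "\<lambda>t. t\<^sup>2"] if_distrib[of "\<lambda>t. t * x _"] cong: if_cong)

lemma square_hod_unit_point_unitary:
  assumes "square_hod n m F" "j \<in> {1..m}"
  shows "unitary_mat n (F (unit_point j))"
  using square_hodD(1,5)[OF assms(1)] sum_unit_point(1)[OF assms(2)]
  by (intro unitary_matI) (simp_all del: of_real_sum)

section \<open>Splitting off a pair of variables\<close>

text \<open>The recursion step of \<open>Hev\<close> with an arbitrary \<open>W\<close> in place of
  the smaller matrix. The lower left scalar is minus the conjugate of the upper right one, written
  as in \<open>Hev\<close> so that the two agree literally.\<close>

definition hod_double ::
  "nat \<Rightarrow> nat \<Rightarrow> ((nat \<Rightarrow> real) \<Rightarrow> complex mat) \<Rightarrow> (nat \<Rightarrow> real) \<Rightarrow> complex mat" where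
  "hod_double d m W x = four_block_mat
     (W x) (Complex (x (m + 1)) (x (m + 2)) \<cdot>\<^sub>m 1\<^sub>m d)
     ((- Complex (x (m + 1)) (- x (m + 2))) \<cdot>\<^sub>m 1\<^sub>m d) (ctrans (W x))"

text \<open>The traces of \<open>X * ctrans X\<close> and \<open>ctrans X * X\<close> are the same
  double sum of squared moduli, summed in two orders; one equals \<open>a\<close> and the other
  \<open>b\<close>.\<close>

lemma dim_eq_of_two_sided_isometry:
  assumes X: "X \<in> carrier_mat a b" and "X * ctrans X = 1\<^sub>m a" and "ctrans X * X = 1\<^sub>m b"
  shows "a = b"
proof -
  have "(\<Sum>i<a. \<Sum>j<b. X $$ (i, j) * cnj (X $$ (i, j))) = (\<Sum>i<a. (X * ctrans X) $$ (i, i))"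
    using X by (intro sum.cong) (auto simp: scalar_prod_def atLeast0LessThan)
  then have 1: "(\<Sum>i<a. \<Sum>j<b. X $$ (i, j) * cnj (X $$ (i, j))) = of_nat a" using assms by simp
  have "(\<Sum>j<b. \<Sum>i<a. X $$ (i, j) * cnj (X $$ (i, j))) = (\<Sum>j<b. (ctrans X * X) $$ (j, j))"
    using X by (intro sum.cong) (auto simp: scalar_prod_def atLeast0LessThan mult.commute)
  then have 2: "(\<Sum>j<b. \<Sum>i<a. X $$ (i, j) * cnj (X $$ (i, j))) = of_nat b" using assms by simp
  from 1 2 have "of_nat a = (of_nat b :: complex)" by (subst (asm) sum.swap) simp
  then show ?thesis by (simp only: of_nat_eq_iff)
qed

text \<open>Right multiplication by this matrix exchanges the two block columns, with a sign. It
  moves \<open>W\<close> from the off-diagonal position, where it arises, to the diagonal position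
  that \<open>hod_double\<close> prescribes.\<close>

definition quarter_turn :: "nat \<Rightarrow> complex mat" where
  "quarter_turn d = four_block_mat (0\<^sub>m d d) (1\<^sub>m d) (- 1\<^sub>m d) (0\<^sub>m d d)"

lemma unitary_quarter_turn: "unitary_mat (d + d) (quarter_turn d)"
proof (rule unitary_matI)
  have "ctrans (quarter_turn d) = four_block_mat (0\<^sub>m d d) (- 1\<^sub>m d) (1\<^sub>m d) (0\<^sub>m d d)"
    unfolding quarter_turn_def by (subst ctrans_four_block_mat[of _ d d _ d _ d]) (auto simp: ctrans_uminus)
  then show "ctrans (quarter_turn d) * quarter_turn d = 1\<^sub>m (d + d)"
    by (simp add: quarter_turn_def mult_four_block_mat[of _ d d _ d _ d _ _ d _ d])
qed (simp add: quarter_turn_def)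

text \<open>Polarization against the two normalised coefficients makes the part in the first
  \<open>m\<close> variables skew-Hermitian and block off-diagonal, hence determined by one block
  \<open>W\<close>. With at least one variable left, \<open>W\<close> takes a value that is an
  isometry on both sides, which forces \<open>a = b\<close>.\<close>

lemma square_hod_split_off_pair:
  assumes H: "square_hod (a + b) (m + 2) H" and m: "m \<ge> 1"
    and H1: "H (unit_point (m + 1)) = 1\<^sub>m (a + b)"
    and H2: "H (unit_point (m + 2)) = four_block_mat (\<i> \<cdot>\<^sub>m 1\<^sub>m a) (0\<^sub>m a b) (0\<^sub>m b a) (- \<i> \<cdot>\<^sub>m 1\<^sub>m b)"
  shows "a = b \<and> (\<exists>W. square_hod a m W \<and> (\<forall>x. H x * quarter_turn a = hod_double a m W x))"
proof -
  \<comment> \<open>\<open>low x\<close> keeps only the first \<open>m\<close> coordinates and is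
    therefore orthogonal to the points \<open>m + 1\<close> and \<open>m + 2\<close>.\<close>
  define low where "low x = (\<lambda>i. if i \<in> {1..m} then x i else (0::real))" for x
  let ?n = "a + b"
  define D where "D x = H (low x)" for x
  note c = square_hodD(1)[OF H]
  have Dc: "D x \<in> carrier_mat ?n ?n" for x using c by (simp add: D_def)
  have skew: "ctrans (D x) = - D x" for x
  proof -
    have "(\<Sum>i=1..m+2. unit_point (m + 1) i * low x i) = 0"
      by (subst sum_unit_point) (auto simp: low_def)
    from square_hod_polarization[OF H this]
    have z: "D x + ctrans (D x) = 0\<^sub>m ?n ?n" 
      using Dc[of x] unfolding H1 D_def[symmetric] by simp
    show ?thesis
    proof (rule eq_matI)
      fix i j assume "i < dim_row (- D x)" "j < dim_col (- D x)"
      then have ij: "i < ?n" "j < ?n" using Dc[of x] by auto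
      then show "ctrans (D x) $$ (i, j) = (- D x) $$ (i, j)"
        using arg_cong[OF z, of "\<lambda>M. M $$ (i, j)"] Dc[of x] by (simp add: add_eq_0_iff)
    qed (use Dc[of x] in auto)
  qed
  \<comment> \<open>Together with \<open>skew\<close>, polarization says that \<open>D x\<close>
    anticommutes with the diagonal matrix \<open>J\<close>. Inside a diagonal block \<open>J\<close>
    has the same entry at \<open>i\<close> and \<open>j\<close>, so the two terms add up to a
    non-zero multiple of the entry of \<open>D x\<close>.\<close>
  have diag0: "D x $$ (i, j) = 0" if ij: "i < ?n" "j < ?n" "i < a \<longleftrightarrow> j < a" for x i j
  proof -
    define J where "J = H (unit_point (m + 2))"
    have J: "J = mat ?n ?n (\<lambda>(i, j). if i = j then if i < a then \<i> else - \<i> else 0)"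
      unfolding J_def H2 by (intro eq_matI) auto
    have "(\<Sum>i=1..m+2. unit_point (m + 2) i * low x i) = 0"
      by (subst sum_unit_point) (auto simp: low_def)
    from square_hod_polarization[OF H this]
    have z: "ctrans J * D x + ctrans (D x) * J = 0\<^sub>m ?n ?n" by (simp add: J_def D_def)
    have e1: "(ctrans J * D x) $$ (i, j) = (if i < a then - \<i> else \<i>) * D x $$ (i, j)"
      using ij Dc[of x]
      by (simp add: J scalar_prod_def if_distrib[of cnj] if_distrib[of "\<lambda>t. t * _"] sum.delta cong: if_cong)
    have e2: "(ctrans (D x) * J) $$ (i, j) = - D x $$ (i, j) * (if j < a then \<i> else - \<i>)"
      using ij Dc[of x] unfolding skew
      by (simp add: J scalar_prod_def if_distrib[of "\<lambda>t. _ * t"] sum.delta cong: if_cong)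
    have "(ctrans J * D x) $$ (i, j) + (ctrans (D x) * J) $$ (i, j) = 0"
      using arg_cong[OF z, of "\<lambda>M. M $$ (i, j)"] ij Dc[of x] by (simp add: J)
    then show ?thesis unfolding e1 e2 using ij(3) by (auto split: if_splits)
  qed
  \<comment> \<open>The sign anticipates \<open>quarter_turn\<close>: its block
    \<open>- 1\<^sub>m a\<close> turns the upper right block \<open>- W x\<close> into
    \<open>W x\<close>. Skewness then makes the lower left block of \<open>D x\<close> equal to
    \<open>ctrans (W x)\<close>.\<close>
  define W where "W x = mat a b (\<lambda>(i, j). - D x $$ (i, a + j))" for x
  have Wc: "W x \<in> carrier_mat a b" for x by (simp add: W_def)
  have D: "D x = four_block_mat (0\<^sub>m a a) (- W x) (ctrans (W x)) (0\<^sub>m b b)" for x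
  proof (rule eq_matI)
    fix i j assume "i < dim_row (four_block_mat (0\<^sub>m a a) (- W x) (ctrans (W x)) (0\<^sub>m b b))"
      "j < dim_col (four_block_mat (0\<^sub>m a a) (- W x) (ctrans (W x)) (0\<^sub>m b b))"
    then have ij: "i < ?n" "j < ?n" by auto
    have "cnj (D x $$ (j, i)) = - D x $$ (i, j)"
      using arg_cong[OF skew[of x], of "\<lambda>M. M $$ (i, j)"] ij Dc[of x] by simp
    then show "D x $$ (i, j) = four_block_mat (0\<^sub>m a a) (- W x) (ctrans (W x)) (0\<^sub>m b b) $$ (i, j)"
      using ij diag0[of i j x] by (auto simp: W_def)
  qed (use Dc[of x] in auto)
  have low_sum: "(\<Sum>i=1..m+2. (low x i)\<^sup>2) = (\<Sum>i=1..m. (x i)\<^sup>2)" for x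
    by (simp add: low_def if_distrib[of "\<lambda>t. t\<^sup>2"] flip: sum.inter_restrict)
  \<comment> \<open>Both products occur as diagonal blocks of \<open>ctrans (D x) * D x\<close>, so
    a single norm identity gives both before \<open>a = b\<close> is known.\<close>
  have WW: "W x * ctrans (W x) = complex_of_real (\<Sum>i=1..m. (x i)\<^sup>2) \<cdot>\<^sub>m 1\<^sub>m a"
      "ctrans (W x) * W x = complex_of_real (\<Sum>i=1..m. (x i)\<^sup>2) \<cdot>\<^sub>m 1\<^sub>m b" for x
  proof -
    let ?s = "complex_of_real (\<Sum>i=1..m. (x i)\<^sup>2)"
    have "ctrans (D x) * D x = four_block_mat (W x * ctrans (W x)) (0\<^sub>m a b) (0\<^sub>m b a) (ctrans (W x) * W x)"
    proof -
      have "ctrans (D x) = four_block_mat (0\<^sub>m a a) (W x) (- ctrans (W x)) (0\<^sub>m b b)"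
        unfolding D using Wc[of x]
        by (subst ctrans_four_block_mat[of _ a a _ b _ b]) (auto simp: ctrans_uminus)
      then show ?thesis
        unfolding D using Wc[of x] ctrans_carrier[OF Wc[of x]]
        by (simp only:, subst mult_four_block_mat[of _ a a _ b _ b _ _ a _ b])
          (auto intro!: cong_four_block_mat)
    qed
    also have "ctrans (D x) * D x = ?s \<cdot>\<^sub>m 1\<^sub>m ?n"
      using square_hodD(5)[OF H, of "low x"] by (simp only: D_def low_sum)
    also have "\<dots> = four_block_mat (?s \<cdot>\<^sub>m 1\<^sub>m a) (0\<^sub>m a b) (0\<^sub>m b a) (?s \<cdot>\<^sub>m 1\<^sub>m b)"
      by (intro eq_matI) auto
    finally have e: "four_block_mat (?s \<cdot>\<^sub>m 1\<^sub>m a) (0\<^sub>m a b) (0\<^sub>m b a) (?s \<cdot>\<^sub>m 1\<^sub>m b) =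
      four_block_mat (W x * ctrans (W x)) (0\<^sub>m a b) (0\<^sub>m b a) (ctrans (W x) * W x)" .
    have car: "W x * ctrans (W x) \<in> carrier_mat a a" "ctrans (W x) * W x \<in> carrier_mat b b"
      using Wc[of x] ctrans_carrier[OF Wc[of x]] by (blast intro: mult_carrier_mat)+
    show "W x * ctrans (W x) = ?s \<cdot>\<^sub>m 1\<^sub>m a" "ctrans (W x) * W x = ?s \<cdot>\<^sub>m 1\<^sub>m b"
      using four_block_mat_eqD(1,4)[OF e, of a a b b] car by simp_all
  qed
  have ab: "a = b"
    using WW[of "unit_point 1"] dim_eq_of_two_sided_isometry[OF Wc[of "unit_point 1"]]
      sum_unit_point(1)[of 1 m] m by (simp del: of_real_sum)
  have low_add: "low (\<lambda>i. x i + y i) = (\<lambda>i. low x i + low y i)" for x y by (auto simp: low_def)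
  have low_mult: "low (\<lambda>i. r * x i) = (\<lambda>i. r * low x i)" for r x by (auto simp: low_def)
  have D_add: "D (\<lambda>i. x i + y i) = D x + D y" for x y
    by (simp only: D_def low_add square_hodD(2)[OF H])
  have D_mult: "D (\<lambda>i. r * x i) = complex_of_real r \<cdot>\<^sub>m D x" for r x
    by (simp only: D_def low_mult square_hodD(3)[OF H])
  have "square_hod a m W"
    unfolding square_hod_def
  proof (intro conjI allI impI)
    show "W x \<in> carrier_mat a a" for x using Wc ab by simp
    show "W (\<lambda>i. x i + y i) = W x + W y" for x y
      using Dc[of x] Dc[of y]
      by (intro eq_matI) (auto simp: W_def D_add)
    show "W (\<lambda>i. r * x i) = complex_of_real r \<cdot>\<^sub>m W x" for r x
      using Dc[of x]
      by (intro eq_matI) (auto simp: W_def D_mult)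
    show "W x = W y" if "\<forall>i\<in>{1..m}. x i = y i" for x y
    proof -
      have "low x = low y" using that by (auto simp: low_def)
      then show ?thesis by (simp add: W_def D_def)
    qed
    show "ctrans (W x) * W x = complex_of_real (\<Sum>i=1..m. (x i)\<^sup>2) \<cdot>\<^sub>m 1\<^sub>m a" for x
      using WW(2) ab by simp
  qed
  moreover have "H x * quarter_turn a = hod_double a m W x" for x
  proof -
    let ?z = "Complex (x (m + 1)) (x (m + 2))"
    \<comment> \<open>The two arguments need to agree only on the indices up to
      \<open>m + 2\<close>; linearity then separates \<open>D x\<close> from the two normalised
      coefficients.\<close>
    have "H x = H (\<lambda>i. low x i + (x (m + 1) * unit_point (m + 1) i + x (m + 2) * unit_point (m + 2) i))"
    proof (rule square_hodD(4)[OF H])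
      fix i assume "i \<in> {1..m + 2}"
      then have "i \<in> {1..m} \<or> i = m + 1 \<or> i = m + 2" by auto
      then show "x i = low x i + (x (m + 1) * unit_point (m + 1) i + x (m + 2) * unit_point (m + 2) i)"
        by (auto simp: low_def unit_point_def)
    qed
    also have "\<dots> = D x + (complex_of_real (x (m + 1)) \<cdot>\<^sub>m 1\<^sub>m ?n + complex_of_real (x (m + 2)) \<cdot>\<^sub>m
        four_block_mat (\<i> \<cdot>\<^sub>m 1\<^sub>m a) (0\<^sub>m a b) (0\<^sub>m b a) (- \<i> \<cdot>\<^sub>m 1\<^sub>m b))"
      by (simp only: square_hodD(2,3)[OF H] H1 H2 D_def)
    also have "\<dots> = four_block_mat (?z \<cdot>\<^sub>m 1\<^sub>m a) (- W x) (ctrans (W x)) (cnj ?z \<cdot>\<^sub>m 1\<^sub>m a)"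
      unfolding D using Wc[of x] ab by (intro eq_matI) (auto simp: complex_eq_iff)
    finally have "H x * quarter_turn a =
        four_block_mat (?z \<cdot>\<^sub>m 1\<^sub>m a) (- W x) (ctrans (W x)) (cnj ?z \<cdot>\<^sub>m 1\<^sub>m a) *
        four_block_mat (0\<^sub>m a a) (1\<^sub>m a) (- 1\<^sub>m a) (0\<^sub>m a a)"
      by (simp only: quarter_turn_def)
    also have "\<dots> = hod_double a m W x"
      using Wc[of x] ab unfolding hod_double_def
      by (subst mult_four_block_mat[of _ a a _ a _ a _ _ a _ a])
        (auto intro!: cong_four_block_mat eq_matI simp: complex_eq_iff)
    finally show ?thesis .
  qed
  ultimately show ?thesis using ab by blast
qed

text \<open>Three unitary changes are composed: \<open>A\<close> makes one coefficient the identity,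
  \<open>Q\<close> diagonalises the next, and \<open>R\<close> is the quarter turn. Undoing them
  leaves \<open>A * Q\<close> on the left and \<open>ctrans R * ctrans Q\<close> on the
  right.\<close>

lemma square_hod_reduction:
  assumes F: "square_hod n (m + 2) F" and m: "m \<ge> 1"
  obtains d W U V where "n = d + d" "square_hod d m W" "unitary_mat n U" "unitary_mat n V"
    "\<forall>x. F x = U * hod_double d m W x * V"
proof -
  define A where "A = F (unit_point (m + 1))"
  have A: "unitary_mat n A" unfolding A_def by (rule square_hod_unit_point_unitary[OF F]) simp
  \<comment> \<open>The trailing identity factor gives \<open>G\<close> the two-sided form in which
    unitary invariance was proved.\<close>
  define G where "G x = ctrans A * F x * 1\<^sub>m n" for x
  have G: "square_hod n (m + 2) G"
    unfolding G_def using square_hod_unitary_mult[OF F unitary_mat_ctrans[OF A] unitary_mat_one] .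
  note Fc = square_hodD(1)[OF F] and Gc = square_hodD(1)[OF G]
  have Ac: "A \<in> carrier_mat n n" using A by (rule unitary_mat_carrier)
  have G1: "G (unit_point (m + 1)) = 1\<^sub>m n"
    using A unfolding G_def A_def[symmetric] by (simp add: unitary_mat_def)
  define C where "C = G (unit_point (m + 2))"
  have Cc: "C \<in> carrier_mat n n" unfolding C_def by (rule Gc)
  have CC: "ctrans C * C = 1\<^sub>m n"
    using square_hod_unit_point_unitary[OF G, of "m + 2"] by (simp add: C_def unitary_mat_def)
  have Ch: "ctrans C = - C"
  proof -
    have "(\<Sum>i=1..m+2. unit_point (m + 1) i * unit_point (m + 2) i) = 0"
      by (subst sum_unit_point) (auto simp: unit_point_def)
    from square_hod_polarization[OF G this]
    have z: "C + ctrans C = 0\<^sub>m n n"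
      using Cc unfolding G1 C_def[symmetric] by simp
    show ?thesis
    proof (rule eq_matI)
      fix i j assume "i < dim_row (- C)" "j < dim_col (- C)"
      then show "ctrans C $$ (i, j) = (- C) $$ (i, j)"
        using arg_cong[OF z, of "\<lambda>M. M $$ (i, j)"] Cc by (simp add: add_eq_0_iff)
    qed (use Cc in auto)
  qed
  \<comment> \<open>Multiplying by \<open>- \<i>\<close> turns the skew-Hermitian unitary
    \<open>C\<close> into a Hermitian involution; the eigenvalues 1 and -1 of \<open>S\<close>
    become \<open>\<i>\<close> and \<open>- \<i>\<close> for \<open>C\<close>.\<close>
  define S where "S = (- \<i>) \<cdot>\<^sub>m C"
  have Sc: "S \<in> carrier_mat n n" using Cc by (simp add: S_def)
  have "ctrans S = S"
    unfolding S_def ctrans_smult Ch by (rule eq_matI) auto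
  moreover have "S * S = 1\<^sub>m n"
  proof -
    have "S * S = (- \<i>) \<cdot>\<^sub>m ((- \<i>) \<cdot>\<^sub>m (C * C))"
      using Cc by (simp add: S_def mult_smult_distrib[of _ n n _ n] mult_smult_assoc_mat[of _ n n _ n])
    also have "\<dots> = - (C * C)" by (intro eq_matI) auto
    also have "\<dots> = ctrans C * C" using Cc by (simp add: Ch)
    finally show ?thesis using CC by simp
  qed
  ultimately obtain Q a b where ab: "a + b = n" and Q: "unitary_mat n Q"
    and J: "ctrans Q * S * Q = four_block_mat (1\<^sub>m a) (0\<^sub>m a b) (0\<^sub>m b a) (- 1\<^sub>m b)"
    using hermitian_involution_diagonalization[OF Sc] by blast
  have Qc: "Q \<in> carrier_mat n n" using Q by (rule unitary_mat_carrier)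
  define H where "H x = ctrans Q * G x * Q" for x
  have H: "square_hod (a + b) (m + 2) H"
    unfolding H_def ab using square_hod_unitary_mult[OF G unitary_mat_ctrans[OF Q] Q] .
  have H1: "H (unit_point (m + 1)) = 1\<^sub>m (a + b)"
    unfolding H_def G1 ab using Qc Q by (simp add: unitary_mat_def)
  have H2: "H (unit_point (m + 2)) = four_block_mat (\<i> \<cdot>\<^sub>m 1\<^sub>m a) (0\<^sub>m a b) (0\<^sub>m b a) (- \<i> \<cdot>\<^sub>m 1\<^sub>m b)"
  proof -
    have "C = \<i> \<cdot>\<^sub>m S" unfolding S_def by (intro eq_matI) auto
    then have "H (unit_point (m + 2)) = \<i> \<cdot>\<^sub>m (ctrans Q * S * Q)"
      unfolding H_def C_def[symmetric] using Qc Sc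
      by (simp add: mult_smult_distrib[of _ n n _ n] mult_smult_assoc_mat[of _ n n _ n])
    also have "\<dots> = four_block_mat (\<i> \<cdot>\<^sub>m 1\<^sub>m a) (0\<^sub>m a b) (0\<^sub>m b a) (- \<i> \<cdot>\<^sub>m 1\<^sub>m b)"
      unfolding J by (intro eq_matI) auto
    finally show ?thesis .
  qed
  from square_hod_split_off_pair[OF H m H1 H2] obtain W where "a = b" and W: "square_hod a m W"
    and HW: "\<And>x. H x * quarter_turn a = hod_double a m W x" by blast
  then have n: "n = a + a" using ab by simp
  define R where "R = quarter_turn a"
  have R: "unitary_mat n R" unfolding R_def n by (rule unitary_quarter_turn)
  have Rc: "R \<in> carrier_mat n n" using R by (rule unitary_mat_carrier)
  have "F x = (A * Q) * hod_double a m W x * (ctrans R * ctrans Q)" for x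
  proof -
    have "(A * Q) * hod_double a m W x * (ctrans R * ctrans Q) =
      A * (Q * (ctrans Q * (ctrans A * (F x * (Q * (R * (ctrans R * ctrans Q)))))))"
      unfolding HW[symmetric] H_def G_def R_def[symmetric] using Ac Qc Rc Fc[of x]
      by (simp add: assoc_mult_mat[of _ n n _ n _ n])
    also have "\<dots> = F x"
      using Ac Qc Rc Fc[of x] A Q R Q[unfolded unitary_mat_def] by (simp add: unitary_mat_cancel[of n _ _ n])
    finally show ?thesis by simp
  qed
  then show thesis
    using that[OF n W unitary_mat_mult[OF A Q] unitary_mat_mult[OF unitary_mat_ctrans[OF R] unitary_mat_ctrans[OF Q]]]
    by blast
qed

section \<open>Divisibility and uniqueness\<close>

lemma square_hod_pow2_dvd:
  "square_hod n (2 * k + 1) F \<Longrightarrow> 2 ^ k dvd n"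
proof (induction k arbitrary: n F)
  case (Suc k)
  then have "square_hod n (2 * k + 1 + 2) F" by simp
  \<comment> \<open>\<open>le_add2\<close> supplies \<open>1 \<le> 2 * k + 1\<close>: as the number
    of variables is odd, one is always left after removing pairs.\<close>
  from square_hod_reduction[OF this le_add2] obtain d W where "n = d + d" "square_hod d (2 * k + 1) W" .
  then show ?case using Suc.IH[of d W] by (simp flip: mult_2)
qed simp

text \<open>An equivalence of the halves lifts to the doubles. The outer factors are chosen so that
  each scalar block is conjugated by a single unitary and stays fixed, while the lower right block
  becomes the conjugate transpose of \<open>U * W x * V\<close>.\<close>

lemma hod_double_unitary_mult:
  assumes U: "unitary_mat d U" and V: "unitary_mat d V" and Wc: "W x \<in> carrier_mat d d"
  shows "hod_double d m (\<lambda>x. U * W x * V) x =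
    four_block_mat U (0\<^sub>m d d) (0\<^sub>m d d) (ctrans V) * hod_double d m W x *
    four_block_mat V (0\<^sub>m d d) (0\<^sub>m d d) (ctrans U)"
proof -
  have c: "U \<in> carrier_mat d d" "V \<in> carrier_mat d d" using U V by (auto dest: unitary_mat_carrier)
  have "four_block_mat U (0\<^sub>m d d) (0\<^sub>m d d) (ctrans V) * hod_double d m W x =
    four_block_mat (U * W x) (Complex (x (m + 1)) (x (m + 2)) \<cdot>\<^sub>m U)
      ((- Complex (x (m + 1)) (- x (m + 2))) \<cdot>\<^sub>m ctrans V) (ctrans V * ctrans (W x))"
    unfolding hod_double_def using c Wc
    by (subst mult_four_block_mat[of _ d d _ d _ d _ _ d _ d])
      (auto intro!: cong_four_block_mat simp: smult_one_mult_mat[of _ d d] simp del: uminus_mult_left_mat)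
  then show ?thesis
    using c Wc U V unfolding hod_double_def unitary_mat_def
    by (simp, subst mult_four_block_mat[of _ d d _ d _ d _ _ d _ d])
      (auto intro!: cong_four_block_mat simp: ctrans_mult[of _ d d _ d] assoc_mult_mat[of _ d d _ d _ d]
        mult_smult_assoc_mat[of _ d d _ d])
qed

lemma hod_double_carrier:
  "W x \<in> carrier_mat d d \<Longrightarrow> hod_double d m W x \<in> carrier_mat (d + d) (d + d)"
  unfolding hod_double_def by simp

text \<open>Both designs reduce to doubles of the same half size, and the equivalence of the halves
  given by induction lifts. With one variable, each design is that variable times a unitary matrix,
  so the quotient of these two matrices serves as \<open>U\<close>.\<close>

lemma square_hod_equivalent:
  assumes "square_hod n (2 * k + 1) F" "square_hod n (2 * k + 1) G"
  shows "\<exists>U V. unitary_mat n U \<and> unitary_mat n V \<and> (\<forall>x. F x = U * G x * V)"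
  using assms
proof (induction k arbitrary: n F G)
  case 0
  let ?A = "F (unit_point 1)" and ?B = "G (unit_point 1)"
  have A: "unitary_mat n ?A" and B: "unitary_mat n ?B"
    using 0 by (auto intro: square_hod_unit_point_unitary)
  have Ac: "?A \<in> carrier_mat n n" and Bc: "?B \<in> carrier_mat n n" using A B by (auto dest: unitary_mat_carrier)
  have *: "K x = complex_of_real (x 1) \<cdot>\<^sub>m K (unit_point 1)" if "square_hod n (2 * 0 + 1) K" for K x
    unfolding square_hodD(3)[OF that, symmetric]
    by (rule square_hodD(4)[OF that]) (auto simp: unit_point_def)
  have "F x = (?A * ctrans ?B) * G x * 1\<^sub>m n" for x
    unfolding *[OF 0(1), of x] *[OF 0(2), of x] using Ac Bc B
    by (simp add: mult_smult_distrib[of _ n n _ n] assoc_mult_mat[of _ n n _ n _ n]) (simp add: unitary_mat_def)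
  then show ?case using unitary_mat_mult[OF A unitary_mat_ctrans[OF B]] unitary_mat_one by blast
next
  case (Suc k)
  have F: "square_hod n (2 * k + 1 + 2) F" and G: "square_hod n (2 * k + 1 + 2) G"
    using Suc.prems by auto
  obtain d W1 U1 V1 where n: "n = d + d" and W1: "square_hod d (2 * k + 1) W1"
    and U1: "unitary_mat n U1" and V1: "unitary_mat n V1"
    and F1: "\<forall>x. F x = U1 * hod_double d (2 * k + 1) W1 x * V1"
    using square_hod_reduction[OF F le_add2] by blast
  obtain d' W2 U2 V2 where n': "n = d' + d'" and W2: "square_hod d' (2 * k + 1) W2"
    and U2: "unitary_mat n U2" and V2: "unitary_mat n V2"
    and G1: "\<forall>x. G x = U2 * hod_double d' (2 * k + 1) W2 x * V2"
    using square_hod_reduction[OF G le_add2] by blast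
  have d': "d' = d" using n n' by simp
  from Suc.IH[OF W1 W2[unfolded d']] obtain U V where U: "unitary_mat d U" and V: "unitary_mat d V"
    and WW: "\<And>x. W1 x = U * W2 x * V" by blast
  then have W1_eq: "W1 = (\<lambda>x. U * W2 x * V)" by auto
  \<comment> \<open>The lifted equivalence is sandwiched between the reduction of \<open>F\<close>
    and the inverse of the reduction of \<open>G\<close>.\<close>
  define U3 V3 where "U3 = four_block_mat U (0\<^sub>m d d) (0\<^sub>m d d) (ctrans V)"
    and "V3 = four_block_mat V (0\<^sub>m d d) (0\<^sub>m d d) (ctrans U)"
  have U3: "unitary_mat n U3" and V3: "unitary_mat n V3"
    unfolding U3_def V3_def n using U V by (auto intro: unitary_mat_block_diag)
  note car = U1[THEN unitary_mat_carrier] V1[THEN unitary_mat_carrier] U2[THEN unitary_mat_carrier]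
    V2[THEN unitary_mat_carrier] U3[THEN unitary_mat_carrier] V3[THEN unitary_mat_carrier]
  have "F x = (U1 * (U3 * ctrans U2)) * G x * (ctrans V2 * (V3 * V1))" for x
  proof -
    define B where "B = hod_double d (2 * k + 1) W2 x"
    have Bc: "B \<in> carrier_mat n n"
      unfolding B_def n using square_hodD(1)[OF W2] d' by (intro hod_double_carrier) simp
    have "F x = U1 * (U3 * B * V3) * V1"
      unfolding F1[rule_format] W1_eq U3_def V3_def B_def
      using hod_double_unitary_mult[OF U V, of W2 x "2 * k + 1"] square_hodD(1)[OF W2] d' by simp
    moreover have "(U1 * (U3 * ctrans U2)) * G x * (ctrans V2 * (V3 * V1)) = U1 * (U3 * B * V3) * V1"
      unfolding G1[rule_format] d' B_def[symmetric] using car Bc U2 V2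
      by (simp add: assoc_mult_mat[of _ n n _ n _ n] unitary_mat_cancel[of n _ _ n])
    ultimately show ?thesis by simp
  qed
  moreover have "unitary_mat n (U1 * (U3 * ctrans U2))" "unitary_mat n (ctrans V2 * (V3 * V1))"
    using U1 U2 U3 V1 V2 V3 by (simp_all add: unitary_mat_mult)
  ultimately show ?case by blast
qed

section \<open>The standard designs\<close>

text \<open>For a non-zero sum of squares, the rescaled conjugate transpose is a left inverse of a
  square matrix and hence a right inverse. If the sum vanishes, so do all variables and
  \<open>F x\<close>. Doubling relies on this, since its lower right block is
  conjugate-transposed.\<close>

lemma square_hod_right:
  assumes F: "square_hod n m F"
  shows "F x * ctrans (F x) = complex_of_real (\<Sum>i=1..m. (x i)\<^sup>2) \<cdot>\<^sub>m 1\<^sub>m n"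
proof (cases "(\<Sum>i=1..m. (x i)\<^sup>2) = 0")
  case True
  then have "\<forall>i\<in>{1..m}. x i = 0" by (subst (asm) sum_nonneg_eq_0_iff) auto
  then have "F x = F (\<lambda>i. 0 * x i)" by (intro square_hodD(4)[OF F]) auto
  also have "\<dots> = 0\<^sub>m n n"
    unfolding square_hodD(3)[OF F] using square_hodD(1)[OF F, of x] by (intro eq_matI) auto
  finally have "F x = 0\<^sub>m n n" .
  then show ?thesis unfolding True by (simp, intro eq_matI) auto
next
  case False
  define s where "s = complex_of_real (\<Sum>i=1..m. (x i)\<^sup>2)"
  have s: "s \<noteq> 0" using False unfolding s_def of_real_eq_0_iff .
  have c: "F x \<in> carrier_mat n n" by (rule square_hodD(1)[OF F])
  have "(inverse s \<cdot>\<^sub>m ctrans (F x)) * F x = inverse s \<cdot>\<^sub>m (s \<cdot>\<^sub>m 1\<^sub>m n)"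
    using c square_hodD(5)[OF F, of x] by (simp add: s_def mult_smult_assoc_mat[of _ n n _ n] del: of_real_sum)
  also have "\<dots> = 1\<^sub>m n" using s by (intro eq_matI) auto
  finally have "F x * (inverse s \<cdot>\<^sub>m ctrans (F x)) = 1\<^sub>m n"
    using c by (intro mat_mult_left_right_inverse[of "inverse s \<cdot>\<^sub>m ctrans (F x)" n "F x"]) auto
  then have "inverse s \<cdot>\<^sub>m (F x * ctrans (F x)) = 1\<^sub>m n"
    using c by (simp add: mult_smult_distrib[of _ n n _ n])
  then have "s \<cdot>\<^sub>m (inverse s \<cdot>\<^sub>m (F x * ctrans (F x))) = s \<cdot>\<^sub>m 1\<^sub>m n" by simp
  moreover have "s \<cdot>\<^sub>m (inverse s \<cdot>\<^sub>m (F x * ctrans (F x))) = F x * ctrans (F x)"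
    using s c by (intro eq_matI) (auto simp: field_simps)
  ultimately show ?thesis by (simp add: s_def)
qed

text \<open>The off-diagonal blocks of the product cancel because scalar blocks commute with
  \<open>W x\<close>. The diagonal blocks are the two products of \<open>W x\<close> with its
  conjugate transpose, each increased by the squared modulus of the new complex variable.\<close>

lemma square_hod_double:
  assumes W: "square_hod d m W"
  shows "square_hod (d + d) (m + 2) (hod_double d m W)"
  unfolding square_hod_def
proof (intro conjI allI impI)
  note c = square_hodD(1)[OF W]
  show "hod_double d m W x \<in> carrier_mat (d + d) (d + d)" for x by (rule hod_double_carrier[of W, OF c])
  show "hod_double d m W (\<lambda>i. x i + y i) = hod_double d m W x + hod_double d m W y" for x y
    using c[of x] c[of y] unfolding hod_double_def square_hodD(2)[OF W]
    by (intro eq_matI) (auto simp: complex_eq_iff)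
  show "hod_double d m W (\<lambda>i. r * x i) = complex_of_real r \<cdot>\<^sub>m hod_double d m W x" for r x
    using c[of x] unfolding hod_double_def square_hodD(3)[OF W]
    by (intro eq_matI) (auto simp: complex_eq_iff)
  show "hod_double d m W x = hod_double d m W y" if "\<forall>i\<in>{1..m + 2}. x i = y i" for x y
    using that square_hodD(4)[OF W, of x y] unfolding hod_double_def by auto
  show "ctrans (hod_double d m W x) * hod_double d m W x =
    complex_of_real (\<Sum>i=1..m + 2. (x i)\<^sup>2) \<cdot>\<^sub>m 1\<^sub>m (d + d)" for x
  proof -
    let ?z = "Complex (x (m + 1)) (x (m + 2))" and ?s = "complex_of_real (\<Sum>i=1..m. (x i)\<^sup>2)"
    have z: "- Complex (x (m + 1)) (- x (m + 2)) = - cnj ?z" by (simp add: complex_eq_iff)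
    have s: "complex_of_real (\<Sum>i=1..m + 2. (x i)\<^sup>2) = ?s + ?z * cnj ?z"
      by (simp add: complex_eq_iff power2_eq_square)
    have "ctrans (hod_double d m W x) =
      four_block_mat (ctrans (W x)) (- ?z \<cdot>\<^sub>m 1\<^sub>m d) (cnj ?z \<cdot>\<^sub>m 1\<^sub>m d) (W x)"
      unfolding hod_double_def z using c[of x]
      by (subst ctrans_four_block_mat[of _ d d _ d _ d]) (auto simp: ctrans_smult)
    then have "ctrans (hod_double d m W x) * hod_double d m W x =
      four_block_mat (ctrans (W x)) (- ?z \<cdot>\<^sub>m 1\<^sub>m d) (cnj ?z \<cdot>\<^sub>m 1\<^sub>m d) (W x) *
      four_block_mat (W x) (?z \<cdot>\<^sub>m 1\<^sub>m d) (- cnj ?z \<cdot>\<^sub>m 1\<^sub>m d) (ctrans (W x))"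
      unfolding hod_double_def z by simp
    also have "\<dots> = four_block_mat ((?s + ?z * cnj ?z) \<cdot>\<^sub>m 1\<^sub>m d) (0\<^sub>m d d) (0\<^sub>m d d) ((?s + ?z * cnj ?z) \<cdot>\<^sub>m 1\<^sub>m d)"
    proof (subst mult_four_block_mat[of _ d d _ d _ d _ _ d _ d])
      show "four_block_mat
          (ctrans (W x) * W x + - ?z \<cdot>\<^sub>m 1\<^sub>m d * (- cnj ?z \<cdot>\<^sub>m 1\<^sub>m d))
          (ctrans (W x) * (?z \<cdot>\<^sub>m 1\<^sub>m d) + - ?z \<cdot>\<^sub>m 1\<^sub>m d * ctrans (W x))
          (cnj ?z \<cdot>\<^sub>m 1\<^sub>m d * W x + W x * (- cnj ?z \<cdot>\<^sub>m 1\<^sub>m d))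
          (cnj ?z \<cdot>\<^sub>m 1\<^sub>m d * (?z \<cdot>\<^sub>m 1\<^sub>m d) + W x * ctrans (W x)) =
        four_block_mat ((?s + ?z * cnj ?z) \<cdot>\<^sub>m 1\<^sub>m d) (0\<^sub>m d d) (0\<^sub>m d d) ((?s + ?z * cnj ?z) \<cdot>\<^sub>m 1\<^sub>m d)"
      proof (rule cong_four_block_mat)
        have 1: "- ?z \<cdot>\<^sub>m 1\<^sub>m d * (- cnj ?z \<cdot>\<^sub>m 1\<^sub>m d) = - cnj ?z \<cdot>\<^sub>m (- ?z \<cdot>\<^sub>m 1\<^sub>m d)"
          "cnj ?z \<cdot>\<^sub>m 1\<^sub>m d * (?z \<cdot>\<^sub>m 1\<^sub>m d) = ?z \<cdot>\<^sub>m (cnj ?z \<cdot>\<^sub>m 1\<^sub>m d)"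
          "ctrans (W x) * (?z \<cdot>\<^sub>m 1\<^sub>m d) = ?z \<cdot>\<^sub>m ctrans (W x)"
          "- ?z \<cdot>\<^sub>m 1\<^sub>m d * ctrans (W x) = - ?z \<cdot>\<^sub>m ctrans (W x)"
          "cnj ?z \<cdot>\<^sub>m 1\<^sub>m d * W x = cnj ?z \<cdot>\<^sub>m W x"
          "W x * (- cnj ?z \<cdot>\<^sub>m 1\<^sub>m d) = - cnj ?z \<cdot>\<^sub>m W x"
          using c[of x] by (simp_all add: smult_one_mult_mat[of _ d d])
        show "ctrans (W x) * W x + - ?z \<cdot>\<^sub>m 1\<^sub>m d * (- cnj ?z \<cdot>\<^sub>m 1\<^sub>m d) = (?s + ?z * cnj ?z) \<cdot>\<^sub>m 1\<^sub>m d"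
          unfolding 1 square_hodD(5)[OF W] by (intro eq_matI) auto
        show "ctrans (W x) * (?z \<cdot>\<^sub>m 1\<^sub>m d) + - ?z \<cdot>\<^sub>m 1\<^sub>m d * ctrans (W x) = 0\<^sub>m d d"
          unfolding 1 using c[of x] by (intro eq_matI) auto
        show "cnj ?z \<cdot>\<^sub>m 1\<^sub>m d * W x + W x * (- cnj ?z \<cdot>\<^sub>m 1\<^sub>m d) = 0\<^sub>m d d"
          unfolding 1 using c[of x] by (intro eq_matI) auto
        show "cnj ?z \<cdot>\<^sub>m 1\<^sub>m d * (?z \<cdot>\<^sub>m 1\<^sub>m d) + W x * ctrans (W x) = (?s + ?z * cnj ?z) \<cdot>\<^sub>m 1\<^sub>m d"
          unfolding 1 square_hod_right[OF W] by (intro eq_matI) auto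
      qed
    qed (use c[of x] in auto)
    also have "\<dots> = (?s + ?z * cnj ?z) \<cdot>\<^sub>m 1\<^sub>m (d + d)" by (intro eq_matI) auto
    finally show ?thesis unfolding s .
  qed
qed

text \<open>\<open>Hev (Suc k)\<close> uses the variables up to \<open>2 * k + 2\<close>, so the
  next recursion step is exactly a doubling with the two variables that follow.\<close>

lemma square_hod_Hev: "square_hod (2 ^ k) (2 * k + 2) (Hev (Suc k))"
proof (induction k)
  case 0
  show ?case
    unfolding square_hod_def
  proof (intro conjI allI impI)
    show "ctrans (Hev (Suc 0) x) * Hev (Suc 0) x =
      complex_of_real (\<Sum>i=1..2 * 0 + 2. (x i)\<^sup>2) \<cdot>\<^sub>m 1\<^sub>m (2 ^ 0)" for x
      by (intro eq_matI) (auto simp: scalar_prod_def numeral_2_eq_2 complex_eq_iff power2_eq_square)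
  qed (auto intro!: eq_matI simp: complex_eq_iff)
next
  case (Suc k)
  have "Hev (Suc (Suc k)) = hod_double (2 ^ k) (2 * k + 2) (Hev (Suc k))"
    by (rule ext) (simp add: hod_double_def Let_def)
  then show ?case using square_hod_double[OF Suc] by (simp add: mult_2)
qed

lemma square_hod_drop_last:
  assumes F: "square_hod n (Suc m) F"
  shows "square_hod n m (\<lambda>x. F (x(Suc m := 0)))"
  unfolding square_hod_def
proof (intro conjI allI impI)
  show "F (x(Suc m := 0)) \<in> carrier_mat n n" for x by (rule square_hodD(1)[OF F])
  show "F ((\<lambda>i. x i + y i)(Suc m := 0)) = F (x(Suc m := 0)) + F (y(Suc m := 0))" for x y
    unfolding square_hodD(2)[OF F, symmetric] by (rule square_hodD(4)[OF F]) simp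
  show "F ((\<lambda>i. r * x i)(Suc m := 0)) = complex_of_real r \<cdot>\<^sub>m F (x(Suc m := 0))" for r x
    unfolding square_hodD(3)[OF F, symmetric] by (rule square_hodD(4)[OF F]) simp
  show "F (x(Suc m := 0)) = F (y(Suc m := 0))" if "\<forall>i\<in>{1..m}. x i = y i" for x y
    using that by (intro square_hodD(4)[OF F]) auto
  show "ctrans (F (x(Suc m := 0))) * F (x(Suc m := 0)) = complex_of_real (\<Sum>i=1..m. (x i)\<^sup>2) \<cdot>\<^sub>m 1\<^sub>m n" for x
  proof -
    have "(\<Sum>i=1..Suc m. ((x(Suc m := 0)) i)\<^sup>2) = (\<Sum>i=1..m. (x i)\<^sup>2)" by simp
    then show ?thesis using square_hodD(5)[OF F, of "x(Suc m := 0)"] by simp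
  qed
qed

lemma square_hod_Hodd: "square_hod (2 ^ k) (2 * k + 1) (Hodd (Suc k))"
proof -
  have "Hodd (Suc k) = (\<lambda>x. Hev (Suc k) (x(Suc (2 * k + 1) := 0)))"
    by (rule ext) (simp add: Hodd_def)
  then show ?thesis using square_hod_drop_last[of "2 ^ k" "2 * k + 1"] square_hod_Hev[of k] by simp
qed

section \<open>Direct sums of designs\<close>

lemma square_hod_direct_sum:
  assumes F: "square_hod a m F" and G: "square_hod b m G"
  shows "square_hod (a + b) m (\<lambda>x. four_block_mat (F x) (0\<^sub>m a b) (0\<^sub>m b a) (G x))"
  unfolding square_hod_def
proof (intro conjI allI impI)
  note c = square_hodD(1)[OF F] square_hodD(1)[OF G]
  let ?K = "\<lambda>x. four_block_mat (F x) (0\<^sub>m a b) (0\<^sub>m b a) (G x)"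
  show "?K x \<in> carrier_mat (a + b) (a + b)" for x using c[of x] by simp
  show "?K (\<lambda>i. x i + y i) = ?K x + ?K y" for x y
    using c[of x] c[of y] unfolding square_hodD(2)[OF F] square_hodD(2)[OF G] by (intro eq_matI) auto
  show "?K (\<lambda>i. r * x i) = complex_of_real r \<cdot>\<^sub>m ?K x" for r x
    using c[of x] unfolding square_hodD(3)[OF F] square_hodD(3)[OF G] by (intro eq_matI) auto
  show "?K x = ?K y" if "\<forall>i\<in>{1..m}. x i = y i" for x y
    using that square_hodD(4)[OF F, of x y] square_hodD(4)[OF G, of x y] by simp
  show "ctrans (?K x) * ?K x = complex_of_real (\<Sum>i=1..m. (x i)\<^sup>2) \<cdot>\<^sub>m 1\<^sub>m (a + b)" for x
  proof -
    have "ctrans (?K x) * ?K x =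
      four_block_mat (ctrans (F x) * F x) (0\<^sub>m a b) (0\<^sub>m b a) (ctrans (G x) * G x)"
      using c[of x] by (simp add: ctrans_block_diag block_diag_mult)
    also have "\<dots> = complex_of_real (\<Sum>i=1..m. (x i)\<^sup>2) \<cdot>\<^sub>m 1\<^sub>m (a + b)"
      unfolding square_hodD(5)[OF F] square_hodD(5)[OF G] by (intro eq_matI) auto
    finally show ?thesis .
  qed
qed

lemma blockdiag_rep_Suc:
  assumes "B \<in> carrier_mat d d"
  shows "blockdiag_rep (Suc r) B = four_block_mat B (0\<^sub>m d (r * d)) (0\<^sub>m (r * d) d) (blockdiag_rep r B)"
proof (rule eq_matI)
  let ?R = "four_block_mat B (0\<^sub>m d (r * d)) (0\<^sub>m (r * d) d) (blockdiag_rep r B)"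
  fix i j assume "i < dim_row ?R" "j < dim_col ?R"
  then have ij: "i < d + r * d" "j < d + r * d" using assms by (auto simp: blockdiag_rep_def)
  then have d: "d > 0" by (cases d) auto
  \<comment> \<open>Removing the first block lowers the block number by one and leaves the position
    inside the block unchanged.\<close>
  have div: "i div d = (if i < d then 0 else Suc ((i - d) div d))" "i mod d = (if i < d then i else (i - d) mod d)" for i
    using d by (auto simp: le_div_geq le_mod_geq)
  have "i - d < r * d" if "\<not> i < d" using that ij by simp
  moreover have "j - d < r * d" if "\<not> j < d" using that ij by simp
  ultimately show "blockdiag_rep (Suc r) B $$ (i, j) = ?R $$ (i, j)"
    using assms ij by (auto simp: blockdiag_rep_def Let_def div[of i] div[of j])
qed (use assms in \<open>auto simp: blockdiag_rep_def\<close>)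

lemma square_hod_blockdiag_rep:
  assumes F: "square_hod d m F"
  shows "square_hod (r * d) m (\<lambda>x. blockdiag_rep r (F x))"
proof (induction r)
  case 0
  show ?case unfolding square_hod_def by (auto simp: blockdiag_rep_def Let_def intro!: eq_matI)
next
  case (Suc r)
  show ?case
    using square_hod_direct_sum[OF F Suc] by (simp add: blockdiag_rep_Suc[OF square_hodD(1)[OF F]])
qed

section \<open>Passage between evaluation maps and coefficient matrices\<close>

lemma square_hod_expansion:
  assumes F: "square_hod n m F"
  shows "F x = design_eval n n m (\<lambda>i. F (unit_point i)) x"
proof (rule eq_matI)
  note c = square_hodD(1)[OF F]
  fix r s assume "r < dim_row (design_eval n n m (\<lambda>i. F (unit_point i)) x)"
    "s < dim_col (design_eval n n m (\<lambda>i. F (unit_point i)) x)"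
  then have rs: "r < n" "s < n" by (auto simp: design_eval_def)
  \<comment> \<open>Additivity handles two summands at a time, so the coordinates of
    \<open>x\<close> are switched on one by one; \<open>t m\<close> agrees with \<open>x\<close> on
    all indices that matter.\<close>
  define t where "t j = (\<lambda>i. if i \<in> {1..j} then x i else 0)" for j :: nat
  have "F (t j) $$ (r, s) = (\<Sum>i=1..j. complex_of_real (x i) * F (unit_point i) $$ (r, s))" for j
  proof (induction j)
    case 0
    have "t 0 = (\<lambda>i. 0 * x i)" by (auto simp: t_def)
    then show ?case using rs c[of x] by (simp only: square_hodD(3)[OF F]) auto
  next
    case (Suc j)
    have "t (Suc j) = (\<lambda>i. t j i + x (Suc j) * unit_point (Suc j) i)"
      by (auto simp: t_def unit_point_def le_Suc_eq)
    then have "F (t (Suc j)) = F (t j) + complex_of_real (x (Suc j)) \<cdot>\<^sub>m F (unit_point (Suc j))"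
      by (simp only: square_hodD(2,3)[OF F])
    then show ?case using rs c[of "t j"] c[of "unit_point (Suc j)"] Suc by simp
  qed
  moreover have "F x = F (t m)" by (rule square_hodD(4)[OF F]) (simp add: t_def)
  ultimately show "F x $$ (r, s) = design_eval n n m (\<lambda>i. F (unit_point i)) x $$ (r, s)"
    using rs by (simp add: design_eval_def)
qed (use square_hodD(1)[OF F, of x] in \<open>auto simp: design_eval_def\<close>)

lemma square_hod_imp_is_HOD:
  assumes F: "square_hod n m F"
  shows "is_HOD n n m (\<lambda>i. F (unit_point i))"
  unfolding is_HOD_def square_hod_expansion[OF F, symmetric]
  using square_hodD(1,5)[OF F] by blast

lemma is_HOD_imp_square_hod:
  assumes "is_HOD n n m A"
  shows "square_hod n m (design_eval n n m A)"
  unfolding square_hod_def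
proof (intro conjI allI impI)
  show "design_eval n n m A x \<in> carrier_mat n n" for x by (simp add: design_eval_def)
  show "design_eval n n m A (\<lambda>i. x i + y i) = design_eval n n m A x + design_eval n n m A y" for x y
    by (intro eq_matI) (auto simp: design_eval_def algebra_simps sum.distrib)
  show "design_eval n n m A (\<lambda>i. r * x i) = complex_of_real r \<cdot>\<^sub>m design_eval n n m A x" for r x
    by (intro eq_matI) (auto simp: design_eval_def sum_distrib_left mult.assoc)
  show "design_eval n n m A x = design_eval n n m A y" if "\<forall>i\<in>{1..m}. x i = y i" for x y
    unfolding design_eval_def using that by (intro eq_matI) (auto intro!: sum.cong)
qed (use assms in \<open>simp add: is_HOD_def\<close>)

theorem theorem3:
  fixes n k :: nat
  assumes "n \<ge> 1" and "k \<ge> 1"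
  shows "((\<exists>A. is_HOD n n (2*k - 1) A) \<longleftrightarrow> 2^(k-1) dvd n) \<and>
         (\<forall>A. is_HOD n n (2*k - 1) A \<longrightarrow>
            (\<exists>U V. unitary_mat n U \<and> unitary_mat n V \<and>
               (\<forall>x::nat \<Rightarrow> real. design_eval n n (2*k - 1) A x =
                   U * blockdiag_rep (n div 2^(k-1)) (Hodd k x) * V)))"
proof -
  \<comment> \<open>Writing \<open>k\<close> as a successor removes the truncated subtractions from
    the exponent and from the number of variables.\<close>
  obtain l where k: "k = Suc l" using assms(2) by (cases k) auto
  have m: "2 * k - 1 = 2 * l + 1" "k - 1 = l" using k by auto
  have dvd: "2 ^ l dvd n" if "is_HOD n n (2 * l + 1) A" for A
    using square_hod_pow2_dvd[OF is_HOD_imp_square_hod[OF that]] .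
  \<comment> \<open>Divisibility makes \<open>n div 2 ^ l\<close> copies of size
    \<open>2 ^ l\<close> fill the size \<open>n\<close> exactly.\<close>
  have H: "square_hod n (2 * l + 1) (\<lambda>x. blockdiag_rep (n div 2 ^ l) (Hodd k x))" if "2 ^ l dvd n"
    using square_hod_blockdiag_rep[OF square_hod_Hodd, of "n div 2 ^ l" l] that by (simp add: k)
  \<comment> \<open>The standard design proves existence when \<open>2 ^ l\<close> divides
    \<open>n\<close>. Conversely, any given design forces this divisibility, so the standard design
    is available for comparison and uniqueness up to equivalence gives the normal form.\<close>
  show ?thesis
    unfolding m
    using dvd square_hod_imp_is_HOD[OF H]
      square_hod_equivalent[OF is_HOD_imp_square_hod H[OF dvd]] by blast
qed

end
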